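(* For every $n$, the $(\wedge,\to)$-homomorphism $h:F_{\wedge,\to}(n)\to\mathcal U(U(n)_{\wedge,\to})$ extending $p_i\mapsto\{x\in U(n)_{\wedge,\to}: x\models p_i\}$ is injective. In particular, $F_{\wedge,\to}(n)$ is finite, and therefore the variety of implicative meet-semilattices is locally finite.
   Context: An implicative meet-semilattice is $(A,\wedge,\to)$ with $(A,\wedge)$ a meet-semilattice and $a\wedge b\le c\iff a\le b\to c$. $F_{\wedge,\to}(n)$ is the free implicative meet-semilattice on $p_1,\dots,p_n$, equivalently the $(\wedge,\to)$-formulas in $p_1,\dots,p_n$ modulo IPC-equivalence. $\mathcal U(X)$ is the Heyting algebra of up-sets of a poset $X$. Models are posets with an order-preserving colouring $c:M\to\{0,1\}^n$ and intuitionistic Kripke semantics ($x\models p_i$ iff $c(x)_i=1$). A point $x$ is separated if for some variable $q$, $x\not\models q$ but all $y>x$ satisfy $q$; $M^s$ denotes the separated points with restricted order and colouring. $U(n)$ is the $n$-universal model: the generated submodel of the canonical model of IPC on $p_1,\dots,p_n$ (prime filters of the free Heyting algebra ordered by inclusion, $c(x)_i=1$ iff $p_i\in x$) consisting of points with finite up-set. For every model of finite depth there is a unique p-morphism (order- and colour-preserving map with the back condition) into $U(n)$; $U(n)^s$ has finite depth, and $U(n)_{\wedge,\to}$ denotes the image of the unique p-morphism $U(n)^s\to U(n)$, a generated submodel of $U(n)$. *)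

theory Defs
  imports Main
begin

text \<open>Propositional variable p_(i+1) is represented by Var i; the formulas
  "in p_1,...,p_n" are those whose variables are all < n.\<close>

datatype fm = Var nat | Bot | Conj fm fm | Disj fm fm | Imp fm fm

fun vars :: "fm \<Rightarrow> nat set" where
  "vars (Var i) = {i}"
| "vars Bot = {}"
| "vars (Conj a b) = vars a \<union> vars b"
| "vars (Disj a b) = vars a \<union> vars b"
| "vars (Imp a b) = vars a \<union> vars b"

definition lang :: "nat \<Rightarrow> fm set" where
  "lang n = {\<phi>. vars \<phi> \<subseteq> {..<n}}"

fun imp_fm :: "fm \<Rightarrow> bool" where
  "imp_fm (Var i) = True"
| "imp_fm Bot = False"
| "imp_fm (Conj a b) = (imp_fm a \<and> imp_fm b)"
| "imp_fm (Disj a b) = False"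
| "imp_fm (Imp a b) = (imp_fm a \<and> imp_fm b)"

inductive ipc :: "fm \<Rightarrow> bool" where
  ax1: "ipc (Imp a (Imp b a))"
| ax2: "ipc (Imp (Imp a (Imp b c)) (Imp (Imp a b) (Imp a c)))"
| ax3: "ipc (Imp (Conj a b) a)"
| ax4: "ipc (Imp (Conj a b) b)"
| ax5: "ipc (Imp a (Imp b (Conj a b)))"
| ax6: "ipc (Imp a (Disj a b))"
| ax7: "ipc (Imp b (Disj a b))"
| ax8: "ipc (Imp (Imp a c) (Imp (Imp b c) (Imp (Disj a b) c)))"
| ax9: "ipc (Imp Bot a)"
| mp: "ipc (Imp a b) \<Longrightarrow> ipc a \<Longrightarrow> ipc b"

definition ipc_equiv :: "fm \<Rightarrow> fm \<Rightarrow> bool" where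
  "ipc_equiv a b \<longleftrightarrow> ipc (Imp a b) \<and> ipc (Imp b a)"

definition Fimp :: "nat \<Rightarrow> fm set set" where
  "Fimp n = {{\<psi>. imp_fm \<psi> \<and> \<psi> \<in> lang n \<and> ipc_equiv \<phi> \<psi>} | \<phi>. imp_fm \<phi> \<and> \<phi> \<in> lang n}"

fun forces :: "'a set \<Rightarrow> ('a \<Rightarrow> 'a \<Rightarrow> bool) \<Rightarrow> ('a \<Rightarrow> nat \<Rightarrow> bool) \<Rightarrow> 'a \<Rightarrow> fm \<Rightarrow> bool" where
  "forces W R V x (Var i) = V x i"
| "forces W R V x Bot = False"
| "forces W R V x (Conj a b) = (forces W R V x a \<and> forces W R V x b)"
| "forces W R V x (Disj a b) = (forces W R V x a \<or> forces W R V x b)"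
| "forces W R V x (Imp a b) = (\<forall>y\<in>W. R x y \<longrightarrow> forces W R V y a \<longrightarrow> forces W R V y b)"

definition pmorph :: "nat \<Rightarrow> 'a set \<Rightarrow> ('a \<Rightarrow> 'a \<Rightarrow> bool) \<Rightarrow> ('a \<Rightarrow> nat \<Rightarrow> bool)
    \<Rightarrow> 'b set \<Rightarrow> ('b \<Rightarrow> 'b \<Rightarrow> bool) \<Rightarrow> ('b \<Rightarrow> nat \<Rightarrow> bool) \<Rightarrow> ('a \<Rightarrow> 'b) \<Rightarrow> bool" where
  "pmorph n W1 R1 V1 W2 R2 V2 f \<longleftrightarrow>
     (\<forall>x\<in>W1. f x \<in> W2)
   \<and> (\<forall>x\<in>W1. \<forall>y\<in>W1. R1 x y \<longrightarrow> R2 (f x) (f y))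
   \<and> (\<forall>x\<in>W1. \<forall>i<n. V2 (f x) i = V1 x i)
   \<and> (\<forall>x\<in>W1. \<forall>z\<in>W2. R2 (f x) z \<longrightarrow> (\<exists>y\<in>W1. R1 x y \<and> f y = z))"

definition separated :: "nat \<Rightarrow> 'a set \<Rightarrow> ('a \<Rightarrow> 'a \<Rightarrow> bool) \<Rightarrow> ('a \<Rightarrow> nat \<Rightarrow> bool) \<Rightarrow> 'a \<Rightarrow> bool" where
  "separated n W R V x \<longleftrightarrow>
     (\<exists>i<n. \<not> V x i \<and> (\<forall>y\<in>W. R x y \<and> y \<noteq> x \<longrightarrow> V y i))"

text \<open>Prime filters of the free Heyting algebra on p_1..p_n, represented as
  sets of formulas of lang n closed under IPC-equivalence (the filter
  conditions: contains top, upward closed, closed under meets; proper; prime).\<close>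
definition prime_filter :: "nat \<Rightarrow> fm set \<Rightarrow> bool" where
  "prime_filter n x \<longleftrightarrow>
     x \<subseteq> lang n
   \<and> Imp Bot Bot \<in> x
   \<and> (\<forall>a\<in>x. \<forall>b\<in>lang n. ipc (Imp a b) \<longrightarrow> b \<in> x)
   \<and> (\<forall>a\<in>x. \<forall>b\<in>x. Conj a b \<in> x)
   \<and> Bot \<notin> x
   \<and> (\<forall>a b. Disj a b \<in> x \<longrightarrow> a \<in> x \<or> b \<in> x)"

definition Can :: "nat \<Rightarrow> fm set set" where
  "Can n = {x. prime_filter n x}"

definition col :: "fm set \<Rightarrow> nat \<Rightarrow> bool" where
  "col x i \<longleftrightarrow> Var i \<in> x"

definition Univ :: "nat \<Rightarrow> fm set set" where
  "Univ n = {x \<in> Can n. finite {y \<in> Can n. x \<subseteq> y}}"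

definition Univ_s :: "nat \<Rightarrow> fm set set" where
  "Univ_s n = {x \<in> Univ n. separated n (Univ n) (\<subseteq>) col x}"

text \<open>U(n)_{\<and>,\<rightarrow>}: image of the (unique) p-morphism U(n)^s \<rightarrow> U(n).\<close>
definition Univ_ai :: "nat \<Rightarrow> fm set set" where
  "Univ_ai n = \<Union>{f ` Univ_s n | f. pmorph n (Univ_s n) (\<subseteq>) col (Univ n) (\<subseteq>) col f}"

text \<open>h : F_{\<and>,\<rightarrow>}(n) \<rightarrow> U(U(n)_{\<and>,\<rightarrow>}), on representatives:
  the up-set of points of U(n)_{\<and>,\<rightarrow>} (with the order and colouring inherited
  from U(n)) forcing the formula.\<close>
definition hmap :: "nat \<Rightarrow> fm \<Rightarrow> fm set set" where
  "hmap n \<phi> = {x \<in> Univ_ai n. forces (Univ_ai n) (\<subseteq>) col x \<phi>}"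

definition ims :: "'a set \<Rightarrow> ('a \<Rightarrow> 'a \<Rightarrow> 'a) \<Rightarrow> ('a \<Rightarrow> 'a \<Rightarrow> 'a) \<Rightarrow> bool" where
  "ims A m i \<longleftrightarrow>
     (\<forall>a\<in>A. \<forall>b\<in>A. m a b \<in> A \<and> i a b \<in> A)
   \<and> (\<forall>a\<in>A. \<forall>b\<in>A. \<forall>c\<in>A. m (m a b) c = m a (m b c))
   \<and> (\<forall>a\<in>A. \<forall>b\<in>A. m a b = m b a)
   \<and> (\<forall>a\<in>A. m a a = a)
   \<and> (\<forall>a\<in>A. \<forall>b\<in>A. \<forall>c\<in>A. (m (m a b) c = m a b) \<longleftrightarrow> (m a (i b c) = a))"

inductive_set gen :: "('a \<Rightarrow> 'a \<Rightarrow> 'a) \<Rightarrow> ('a \<Rightarrow> 'a \<Rightarrow> 'a) \<Rightarrow> 'a set \<Rightarrow> 'a set"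
  for m i S where
  base: "a \<in> S \<Longrightarrow> a \<in> gen m i S"
| meet: "a \<in> gen m i S \<Longrightarrow> b \<in> gen m i S \<Longrightarrow> m a b \<in> gen m i S"
| imp: "a \<in> gen m i S \<Longrightarrow> b \<in> gen m i S \<Longrightarrow> i a b \<in> gen m i S"

end

theory Submission
  imports Defs
begin

text \<open>
  Deductively closed sets of formulas, cut down to the subformulas of a
  \<open>(\<and>,\<rightarrow>)\<close>-formula, form a finite countermodel; primeness is not needed
  because disjunction is absent. In a model with finite principal up-sets the map sending a
  point to its theory is a p-morphism into \<open>U(n)\<close>, so the countermodel transfers to
  \<open>U(n)\<close>. A variable that fails at \<open>x\<close> fails at a separated point above \<open>x\<close>, hence
  \<open>(\<and>,\<rightarrow>)\<close>-formulas are evaluated correctly by the separated points alone, and the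
  countermodel transfers to \<open>U(n)\<^sup>s\<close> and to its p-morphic image.

  Passing to a proper successor in \<open>U(n)\<^sup>s\<close> makes some variable true, and a theory is
  determined by the colour and by the theories of the proper successors; so only finitely many
  theories occur in \<open>U(n)\<^sup>s\<close>. Finally, an implicative meet-semilattice with reversed order is
  itself a Kripke model in which \<open>x\<close> forces \<open>\<phi>\<close> iff \<open>x\<close> lies below the value of \<open>\<phi>\<close>, so
  IPC-equivalent formulas have equal values.
\<close>

section \<open>Preliminaries on images, formulas and derivability\<close>

text \<open>On \<open>A\<close>, \<open>f\<close> factors through \<open>k\<close> by a choice of
  preimages. This one counting principle serves for theories, for formula classes and for values of
  terms.\<close>

lemma finite_image_if_determined:
  assumes "finite (k ` A)" and det: "\<And>x y. x \<in> A \<Longrightarrow> y \<in> A \<Longrightarrow> k x = k y \<Longrightarrow> f x = f y"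
  shows "finite (f ` A)"
proof (rule finite_subset)
  show "f ` A \<subseteq> (\<lambda>c. f (inv_into A k c)) ` k ` A"
  proof
    fix z assume "z \<in> f ` A"
    then obtain x where x: "x \<in> A" "z = f x" by blast
    have "f (inv_into A k (k x)) = f x"
      using x by (intro det) (auto intro: inv_into_into f_inv_into_f)
    then show "z \<in> (\<lambda>c. f (inv_into A k c)) ` k ` A"
      using x by force
  qed
qed (use assms in simp)

lemma lang_simps [simp]:
  "Var i \<in> lang n \<longleftrightarrow> i < n"
  "Bot \<in> lang n"
  "Conj a b \<in> lang n \<longleftrightarrow> a \<in> lang n \<and> b \<in> lang n"
  "Disj a b \<in> lang n \<longleftrightarrow> a \<in> lang n \<and> b \<in> lang n"
  "Imp a b \<in> lang n \<longleftrightarrow> a \<in> lang n \<and> b \<in> lang n"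
  by (auto simp: lang_def)

lemma ipc_refl: "ipc (Imp a a)"
  by (meson ipc.ax1 ipc.ax2 ipc.mp)

lemma ipc_weaken: "ipc b \<Longrightarrow> ipc (Imp a b)"
  by (meson ipc.ax1 ipc.mp)

lemma ipc_trans: "ipc (Imp a b) \<Longrightarrow> ipc (Imp b c) \<Longrightarrow> ipc (Imp a c)"
  by (meson ipc_weaken ipc.ax2 ipc.mp)

lemma ipc_equiv_refl: "ipc_equiv a a"
  by (simp add: ipc_equiv_def ipc_refl)

section \<open>Kripke models and their theories\<close>

text \<open>The carrier is an explicit set, so that submodels such as the separated points are again
  instances over the same relation and colouring.\<close>

locale kripke =
  fixes W :: "'w set" and R :: "'w \<Rightarrow> 'w \<Rightarrow> bool" and V :: "'w \<Rightarrow> nat \<Rightarrow> bool"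
  assumes R_refl: "x \<in> W \<Longrightarrow> R x x"
    and R_trans: "x \<in> W \<Longrightarrow> y \<in> W \<Longrightarrow> z \<in> W \<Longrightarrow> R x y \<Longrightarrow> R y z \<Longrightarrow> R x z"
    and R_antisym: "x \<in> W \<Longrightarrow> y \<in> W \<Longrightarrow> R x y \<Longrightarrow> R y x \<Longrightarrow> x = y"
    and V_mono: "x \<in> W \<Longrightarrow> y \<in> W \<Longrightarrow> R x y \<Longrightarrow> V x i \<Longrightarrow> V y i"
begin

lemma kripke_subset: "S \<subseteq> W \<Longrightarrow> kripke S R V"
  by unfold_locales (blast intro: R_refl R_trans R_antisym V_mono)+

abbreviation forced :: "'w \<Rightarrow> fm \<Rightarrow> bool" (infix "\<Turnstile>" 50) where
  "x \<Turnstile> \<phi> \<equiv> forces W R V x \<phi>"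

lemma persistence: "x \<in> W \<Longrightarrow> y \<in> W \<Longrightarrow> R x y \<Longrightarrow> x \<Turnstile> \<phi> \<Longrightarrow> y \<Turnstile> \<phi>"
proof (induction \<phi>)
  case (Imp a b)
  then show ?case by (auto intro: R_trans)
qed (auto intro: V_mono)

lemma soundness: "ipc \<phi> \<Longrightarrow> x \<in> W \<Longrightarrow> x \<Turnstile> \<phi>"
proof (induction arbitrary: x rule: ipc.induct)
  case (ax1 a b)
  then show ?case by (auto intro: persistence)
next
  case (ax2 a b c)
  show ?case
    unfolding forces.simps by (meson R_refl R_trans ax2)
next
  case (ax5 a b)
  then show ?case by (auto intro: persistence)
next
  case (ax8 a c b)
  show ?case
    unfolding forces.simps by (meson R_trans ax8)
next
  case (mp a b)
  then show ?case using R_refl by auto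
qed auto

definition truths :: "nat \<Rightarrow> 'w \<Rightarrow> fm set" where
  "truths n x = {\<phi> \<in> lang n. x \<Turnstile> \<phi>}"

lemma truths_mono: "x \<in> W \<Longrightarrow> y \<in> W \<Longrightarrow> R x y \<Longrightarrow> truths n x \<subseteq> truths n y"
  by (auto simp: truths_def intro: persistence)

lemma prime_filter_truths:
  assumes "x \<in> W" shows "prime_filter n (truths n x)"
proof -
  have "x \<Turnstile> b" if "x \<Turnstile> a" "ipc (Imp a b)" for a b
    using soundness[OF that(2) assms] that(1) assms R_refl by auto
  then show ?thesis
    by (auto simp: prime_filter_def truths_def)
qed

text \<open>Each \<open>y\<close> has a theory other than \<open>F\<close>, so either some member of
  \<open>F\<close> fails at \<open>y\<close> and is added to \<open>\<alpha>\<close> as a conjunct,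
  or some non-member holds at \<open>y\<close> and is added to \<open>\<beta>\<close> as a disjunct.
  Primeness of \<open>F\<close> keeps the growing disjunction outside \<open>F\<close>.\<close>

lemma separating_implication:
  assumes F: "prime_filter n F" and "finite Y" "\<forall>y\<in>Y. truths n y \<noteq> F"
  shows "\<exists>\<alpha>\<in>F. \<exists>\<beta>\<in>lang n - F. \<forall>y\<in>Y. y \<Turnstile> \<alpha> \<longrightarrow> y \<Turnstile> \<beta>"
  using assms(2,3)
proof (induction rule: finite_induct)
  case empty
  \<comment> \<open>\<open>Imp Bot Bot\<close> and \<open>Bot\<close> are the initial
    \<open>\<alpha>\<close> and \<open>\<beta>\<close>.\<close>
  then show ?case using F unfolding prime_filter_def by (metis Diff_iff empty_iff lang_simps(2))
next
  case (insert y Y)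
  then obtain \<alpha> \<beta> where ab: "\<alpha> \<in> F" "\<beta> \<in> lang n" "\<beta> \<notin> F" "\<forall>y\<in>Y. y \<Turnstile> \<alpha> \<longrightarrow> y \<Turnstile> \<beta>"
    by auto
  have "F \<subseteq> lang n" using F by (simp add: prime_filter_def)
  then consider \<alpha>' where "\<alpha>' \<in> F" "\<not> y \<Turnstile> \<alpha>'" | \<beta>' where "\<beta>' \<in> lang n" "\<beta>' \<notin> F" "y \<Turnstile> \<beta>'"
    using insert.prems by (auto simp: truths_def)
  then show ?case
  proof cases
    case 1
    have "Conj \<alpha> \<alpha>' \<in> F" using F ab(1) 1(1) by (simp add: prime_filter_def)
    then show ?thesis using 1 ab by (intro bexI[of _ "Conj \<alpha> \<alpha>'"] bexI[of _ \<beta>]) auto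
  next
    case 2
    have "Disj \<beta> \<beta>' \<in> lang n - F" using F ab 2 by (auto simp: prime_filter_def)
    then show ?thesis using 2 ab by (intro bexI[of _ \<alpha>] bexI[of _ "Disj \<beta> \<beta>'"]) auto
  qed
qed

text \<open>The back condition. If \<open>F\<close> were not the theory of a successor, the
  separating implication for the finite up-set of \<open>x\<close> would be forced at
  \<open>x\<close>, hence lie in \<open>F\<close>, and modus ponens inside \<open>F\<close> would
  give \<open>\<beta> \<in> F\<close>.\<close>

lemma truths_back:
  assumes x: "x \<in> W" and fin: "finite {y \<in> W. R x y}"
    and F: "prime_filter n F" "truths n x \<subseteq> F"
  shows "\<exists>y\<in>W. R x y \<and> truths n y = F"
proof (rule ccontr)
  assume "\<not> ?thesis"
  then have "\<forall>y\<in>{y \<in> W. R x y}. truths n y \<noteq> F" by auto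
  from separating_implication[OF F(1) fin this] obtain \<alpha> \<beta>
    where ab: "\<alpha> \<in> F" "\<beta> \<in> lang n" "\<beta> \<notin> F" "x \<Turnstile> Imp \<alpha> \<beta>" by auto
  have "\<alpha> \<in> lang n" using ab(1) F(1) by (auto simp: prime_filter_def)
  then have "Imp \<alpha> \<beta> \<in> F" using ab F(2) by (auto simp: truths_def)
  then have "Conj (Imp \<alpha> \<beta>) \<alpha> \<in> F" using ab(1) F(1) by (simp add: prime_filter_def)
  moreover have "ipc (Imp (Conj (Imp \<alpha> \<beta>) \<alpha>) \<beta>)"
    by (meson ipc.ax2 ipc.ax3 ipc.ax4 ipc.mp)
  ultimately show False using F(1) ab(2,3) by (auto simp: prime_filter_def)
qed

text \<open>By the back condition, the prime filters above the theory of \<open>x\<close> are all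
  theories of points in the finite up-set of \<open>x\<close>.\<close>

lemma truths_in_Univ:
  assumes x: "x \<in> W" and fin: "finite {y \<in> W. R x y}"
  shows "truths n x \<in> Univ n"
proof -
  have "{F \<in> Can n. truths n x \<subseteq> F} \<subseteq> truths n ` {y \<in> W. R x y}"
    using truths_back[OF x fin] by (fastforce simp: Can_def)
  then have "finite {F \<in> Can n. truths n x \<subseteq> F}"
    using fin finite_surj by blast
  then show ?thesis
    using prime_filter_truths[OF x] by (simp add: Univ_def Can_def)
qed

lemma pmorph_truths:
  assumes fin: "\<And>x. x \<in> W \<Longrightarrow> finite {y \<in> W. R x y}"
  shows "pmorph n W R V (Univ n) (\<subseteq>) col (truths n)"
  unfolding pmorph_def
proof (intro conjI ballI allI impI)
  fix x z assume "x \<in> W" "z \<in> Univ n" "truths n x \<subseteq> z"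
  then show "\<exists>y\<in>W. R x y \<and> truths n y = z"
    using truths_back fin by (auto simp: Univ_def Can_def)
next
  fix x i assume "x \<in> W" "i < n"
  then show "col (truths n x) i = V x i" by (auto simp: col_def truths_def)
qed (use truths_in_Univ fin truths_mono in auto)

lemma truths_determined:
  assumes x: "x \<in> W" "y \<in> W"
    and col: "{i. i < n \<and> V x i} = {i. i < n \<and> V y i}"
    and succ: "truths n ` {z \<in> W. R x z \<and> z \<noteq> x} = truths n ` {z \<in> W. R y z \<and> z \<noteq> y}"
  shows "truths n x = truths n y"
proof -
  \<comment> \<open>Successors of \<open>u\<close> are \<open>u\<close> itself and the proper ones,
    and the latter enter only through their theories.\<close>
  have split: "u \<Turnstile> Imp a b \<longleftrightarrow> (u \<Turnstile> a \<longrightarrow> u \<Turnstile> b) \<and>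
      (\<forall>t\<in>truths n ` {z \<in> W. R u z \<and> z \<noteq> u}. a \<in> t \<longrightarrow> b \<in> t)"
    if "u \<in> W" "a \<in> lang n" "b \<in> lang n" for u a b
    using that R_refl by (auto simp: truths_def)
  have "\<phi> \<in> lang n \<Longrightarrow> x \<Turnstile> \<phi> \<longleftrightarrow> y \<Turnstile> \<phi>" for \<phi>
  proof (induction \<phi>)
    case (Var i)
    then show ?case using col by auto
  next
    case (Imp a b)
    then have "a \<in> lang n" "b \<in> lang n" by auto
    with Imp.IH show ?case
      unfolding split[OF x(1) \<open>a \<in> _\<close> \<open>b \<in> _\<close>] split[OF x(2) \<open>a \<in> _\<close> \<open>b \<in> _\<close>] succ by auto
  qed auto
  then show ?thesis by (auto simp: truths_def)
qed

text \<open>Points are layered by the number of false variables. A theory in one layer is fixed by a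
  colour and a set of theories from the layer below, so finiteness passes upward.\<close>

lemma finite_truths:
  assumes strict: "\<And>x y. x \<in> W \<Longrightarrow> y \<in> W \<Longrightarrow> R x y \<Longrightarrow> y \<noteq> x \<Longrightarrow>
      {i. i < n \<and> \<not> V y i} \<subset> {i. i < n \<and> \<not> V x i}"
  shows "finite (truths n ` W)"
proof -
  \<comment> \<open>The inequality is strict, so \<open>L 0\<close> is empty and all of
    \<open>W\<close> is reached at \<open>Suc n\<close>.\<close>
  define L where "L k = {x \<in> W. card {i. i < n \<and> \<not> V x i} < k}" for k
  have "finite (truths n ` L k)" for k
  proof (induction k)
    case 0
    then show ?case by (simp add: L_def)
  next
    case (Suc k)
    define key where
      "key x = ({i. i < n \<and> V x i}, truths n ` {z \<in> W. R x z \<and> z \<noteq> x})" for x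
    have "z \<in> L k" if "x \<in> L (Suc k)" "z \<in> W" "R x z" "z \<noteq> x" for x z
      using psubset_card_mono[OF _ strict[of x z]] that by (auto simp: L_def)
    then have "key ` L (Suc k) \<subseteq> Pow {..<n} \<times> Pow (truths n ` L k)"
      by (force simp: key_def)
    then have "finite (key ` L (Suc k))"
      using Suc by (meson finite_Pow_iff finite_SigmaI finite_lessThan finite_subset)
    then show ?case
    proof (rule finite_image_if_determined)
      show "truths n x = truths n y" if "x \<in> L (Suc k)" "y \<in> L (Suc k)" "key x = key y" for x y
        using that by (intro truths_determined) (simp_all add: key_def L_def)
    qed
  qed
  moreover have "W = L (Suc n)"
  proof -
    have "card {i. i < n \<and> \<not> V x i} \<le> card {..<n}" for x
      by (intro card_mono) auto
    then show ?thesis by (auto simp: L_def less_Suc_eq_le)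
  qed
  ultimately show ?thesis by metis
qed

section \<open>Separated points\<close>

definition separated_points :: "nat \<Rightarrow> 'w set" where
  "separated_points n = {x \<in> W. separated n W R V x}"

text \<open>Among the points above \<open>x\<close> where variable \<open>i\<close> fails, a maximal
  one is separated, with \<open>i\<close> as witness.\<close>

lemma separated_point_above:
  assumes x: "x \<in> W" and fin: "finite {y \<in> W. R x y}" and i: "i < n" "\<not> V x i"
  shows "\<exists>y\<in>separated_points n. R x y \<and> \<not> V y i"
proof -
  let ?A = "{y \<in> W. R x y \<and> \<not> V y i}"
  let ?S = "\<lambda>y z. R y z \<and> y \<noteq> z"
  have "\<exists>y\<in>?A. \<forall>z\<in>?A. z \<noteq> y \<longrightarrow> \<not> ?S y z"
  proof (rule Finite_Set.bex_max_element)
    show "finite ?A" by (rule finite_subset[OF _ fin]) auto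
    show "asymp_on ?A ?S" by (auto intro!: asymp_onI dest: R_antisym)
    show "transp_on ?A ?S"
    proof (rule transp_onI)
      fix a b c assume "a \<in> ?A" "b \<in> ?A" "c \<in> ?A" "?S a b" "?S b c"
      then show "?S a c" using R_trans[of a b c] R_antisym[of a b] by auto
    qed
    show "?A \<noteq> {}" using x i R_refl by auto
  qed
  then obtain y where y: "y \<in> W" "R x y" "\<not> V y i" and max: "\<forall>z\<in>?A. R y z \<longrightarrow> z = y"
    by auto
  have "V z i" if "z \<in> W" "R y z" "z \<noteq> y" for z
    using max that R_trans[OF x y(1) that(1) y(2) that(2)] by blast
  then have "separated n W R V y" using y(3) i(1) unfolding separated_def by blast
  then show ?thesis using y by (auto simp: separated_points_def)
qed

text \<open>Since \<open>x\<close> itself may not be separated, its truth is compared with truth at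
  all separated points above it. This form commutes with conjunction and implication but not with
  disjunction, as different points may satisfy different disjuncts.\<close>

lemma forces_separated_points:
  assumes fin: "\<And>x. x \<in> W \<Longrightarrow> finite {y \<in> W. R x y}"
    and "imp_fm \<phi>" "\<phi> \<in> lang n" "x \<in> W"
  shows "x \<Turnstile> \<phi> \<longleftrightarrow>
    (\<forall>y\<in>separated_points n. R x y \<longrightarrow> forces (separated_points n) R V y \<phi>)"
  using assms(2-)
proof (induction \<phi> arbitrary: x)
  case (Var i)
  have "separated_points n \<subseteq> W" by (auto simp: separated_points_def)
  then show ?case
    using Var separated_point_above[OF _ fin, of x i n] V_mono[of x _ i] by auto
next
  case (Imp a b)
  let ?S = "separated_points n"
  have S: "?S \<subseteq> W" by (auto simp: separated_points_def)
  interpret S: kripke ?S R V by (rule kripke_subset[OF S])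
  have IHa: "z \<Turnstile> a \<longleftrightarrow> (\<forall>y\<in>?S. R z y \<longrightarrow> forces ?S R V y a)"
    and IHb: "z \<Turnstile> b \<longleftrightarrow> (\<forall>y\<in>?S. R z y \<longrightarrow> forces ?S R V y b)" if "z \<in> W" for z
    using Imp that by auto
  \<comment> \<open>At a separated point the two notions of forcing coincide: instantiate the
    induction hypothesis at the point itself and use persistence.\<close>
  have at_S: "forces ?S R V z a \<longleftrightarrow> z \<Turnstile> a" "forces ?S R V z b \<longleftrightarrow> z \<Turnstile> b" if "z \<in> ?S" for z
    using that S.persistence[of z] R_refl[of z] IHa[of z] IHb[of z] S by blast+
  show ?case
  proof
    assume *: "x \<Turnstile> Imp a b"
    show "\<forall>y\<in>?S. R x y \<longrightarrow> forces ?S R V y (Imp a b)"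
    proof (intro ballI impI)
      fix y assume y: "y \<in> ?S" "R x y"
      have "forces ?S R V z b" if z: "z \<in> ?S" "R y z" "forces ?S R V z a" for z
      proof -
        have "z \<in> W" "R x z" using z y S Imp.prems(3) R_trans[of x y z] by blast+
        then show ?thesis using * z at_S by simp
      qed
      then show "forces ?S R V y (Imp a b)" by simp
    qed
  next
    assume *: "\<forall>y\<in>?S. R x y \<longrightarrow> forces ?S R V y (Imp a b)"
    have "z \<Turnstile> b" if z: "z \<in> W" "R x z" "z \<Turnstile> a" for z
      unfolding IHb[OF z(1)]
    proof (intro ballI impI)
      fix y assume y: "y \<in> ?S" "R z y"
      then have "R x y" using z S Imp.prems(3) R_trans[of x z y] by blast
      moreover have "forces ?S R V y a" using IHa[OF z(1)] z(3) y by blast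
      ultimately show "forces ?S R V y b" using * y S.R_refl[OF y(1)] by simp
    qed
    then show "x \<Turnstile> Imp a b" by simp
  qed
qed auto

lemma finite_truths_separated_points:
  "finite (kripke.truths (separated_points n) R V n ` separated_points n)"
proof -
  let ?S = "separated_points n"
  have S: "?S \<subseteq> W" by (auto simp: separated_points_def)
  interpret S: kripke ?S R V by (rule kripke_subset[OF S])
  show ?thesis
  proof (rule S.finite_truths)
    fix x y assume xy: "x \<in> ?S" "y \<in> ?S" "R x y" "y \<noteq> x"
    then obtain i where "i < n" "\<not> V x i" "V y i"
      by (auto simp: separated_points_def separated_def)
    then show "{i. i < n \<and> \<not> V y i} \<subset> {i. i < n \<and> \<not> V x i}"
      using S.V_mono[OF xy(1-3)] by blast
  qed
qed

end

section \<open>P-morphisms\<close>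

lemma forces_pmorph:
  assumes f: "pmorph n W1 R1 V1 W2 R2 V2 f"
  shows "x \<in> W1 \<Longrightarrow> \<phi> \<in> lang n \<Longrightarrow> forces W2 R2 V2 (f x) \<phi> \<longleftrightarrow> forces W1 R1 V1 x \<phi>"
proof (induction \<phi> arbitrary: x)
  case (Var i)
  then show ?case using f by (simp add: pmorph_def)
next
  case (Imp a b)
  have IH: "forces W2 R2 V2 (f y) a \<longleftrightarrow> forces W1 R1 V1 y a"
    "forces W2 R2 V2 (f y) b \<longleftrightarrow> forces W1 R1 V1 y b" if "y \<in> W1" for y
    using that Imp by simp_all
  have forth: "f y \<in> W2 \<and> (R1 x y \<longrightarrow> R2 (f x) (f y))" if "y \<in> W1" for y
    using f that \<open>x \<in> W1\<close> unfolding pmorph_def by blast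
  have lift: "\<exists>y\<in>W1. R1 x y \<and> f y = z" if "z \<in> W2" "R2 (f x) z" for z
    using f that \<open>x \<in> W1\<close> unfolding pmorph_def by blast
  show ?case
  proof
    assume *: "forces W2 R2 V2 (f x) (Imp a b)"
    have "forces W1 R1 V1 y b" if "y \<in> W1" "R1 x y" "forces W1 R1 V1 y a" for y
      using * forth[OF that(1)] IH[OF that(1)] that unfolding forces.simps by blast
    then show "forces W1 R1 V1 x (Imp a b)" by simp
  next
    assume *: "forces W1 R1 V1 x (Imp a b)"
    have "forces W2 R2 V2 z b" if z: "z \<in> W2" "R2 (f x) z" "forces W2 R2 V2 z a" for z
    proof -
      obtain y where y: "y \<in> W1" "R1 x y" "f y = z" using lift z by blast
      show ?thesis using * IH[OF y(1)] y z(3) by simp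
    qed
    then show "forces W2 R2 V2 (f x) (Imp a b)" by simp
  qed
qed simp_all

text \<open>Needed because \<open>hmap\<close> evaluates formulas in \<open>Univ_ai n\<close>,
  whereas the theory map is first obtained as a p-morphism into \<open>Univ n\<close>.\<close>

lemma pmorph_restrict_codomain:
  assumes f: "pmorph n W1 R1 V1 W2 R2 V2 f" and W: "f ` W1 \<subseteq> W" "W \<subseteq> W2"
  shows "pmorph n W1 R1 V1 W R2 V2 f"
  unfolding pmorph_def
proof (intro conjI)
  show "\<forall>x\<in>W1. f x \<in> W" using W(1) by blast
  show "\<forall>x\<in>W1. \<forall>z\<in>W. R2 (f x) z \<longrightarrow> (\<exists>y\<in>W1. R1 x y \<and> f y = z)"
    using f W(2) unfolding pmorph_def by (meson subsetD)
qed (use f in \<open>simp_all add: pmorph_def\<close>)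

section \<open>Finite countermodels\<close>

fun subfms :: "fm \<Rightarrow> fm set" where
  "subfms (Var i) = {Var i}"
| "subfms Bot = {Bot}"
| "subfms (Conj a b) = insert (Conj a b) (subfms a \<union> subfms b)"
| "subfms (Disj a b) = insert (Disj a b) (subfms a \<union> subfms b)"
| "subfms (Imp a b) = insert (Imp a b) (subfms a \<union> subfms b)"

lemma finite_subfms: "finite (subfms \<phi>)"
  by (induction \<phi>) auto

lemma subfms_self: "\<phi> \<in> subfms \<phi>"
  by (cases \<phi>) auto

lemma subfms_trans: "\<psi> \<in> subfms \<phi> \<Longrightarrow> subfms \<psi> \<subseteq> subfms \<phi>"
  by (induction \<phi>) auto

definition ded_closed :: "fm set \<Rightarrow> bool" where
  "ded_closed T \<longleftrightarrow> (\<forall>a. ipc a \<longrightarrow> a \<in> T) \<and> (\<forall>a b. Imp a b \<in> T \<longrightarrow> a \<in> T \<longrightarrow> b \<in> T)"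

text \<open>By the deduction theorem, \<open>{c. Imp a c \<in> T}\<close> is the theory generated by
  \<open>T\<close> and \<open>a\<close>, described without derivations from assumptions.\<close>

lemma ded_closed_extend:
  assumes "ded_closed T"
  shows "ded_closed {c. Imp a c \<in> T}" "T \<subseteq> {c. Imp a c \<in> T}" "a \<in> {c. Imp a c \<in> T}"
proof -
  have mp: "c \<in> T" if "Imp b c \<in> T" "b \<in> T" for b c
    using assms that unfolding ded_closed_def by blast
  have ax: "b \<in> T" if "ipc b" for b
    using assms that unfolding ded_closed_def by blast
  show "ded_closed {c. Imp a c \<in> T}"
    unfolding ded_closed_def mem_Collect_eq
  proof (intro conjI allI impI)
    show "Imp a b \<in> T" if "ipc b" for b
      using ax ipc_weaken that by blast
    show "Imp a c \<in> T" if "Imp a (Imp b c) \<in> T" "Imp a b \<in> T" for b c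
      using mp[OF mp[OF ax[OF ipc.ax2]]] that by blast
  qed
  show "T \<subseteq> {c. Imp a c \<in> T}"
    using mp[OF ax[OF ipc.ax1]] by blast
  show "a \<in> {c. Imp a c \<in> T}"
    using ax[OF ipc_refl] by blast
qed

lemma ded_closed_Conj: "ded_closed T \<Longrightarrow> Conj a b \<in> T \<longleftrightarrow> a \<in> T \<and> b \<in> T"
  unfolding ded_closed_def using ipc.ax3[of a b] ipc.ax4[of a b] ipc.ax5[of a b] by metis

definition cut_theories :: "fm \<Rightarrow> fm set set" where
  "cut_theories \<chi> = (\<lambda>T. T \<inter> subfms \<chi>) ` {T. ded_closed T}"

lemma finite_cut_theories: "finite (cut_theories \<chi>)"
  by (rule finite_subset[of _ "Pow (subfms \<chi>)"]) (auto simp: cut_theories_def finite_subfms)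

lemma kripke_sets: "kripke W (\<subseteq>) col"
  by unfold_locales (auto simp: col_def)

text \<open>The truth lemma, for every theory \<open>T\<close> representing a given cut point. If
  \<open>Imp a b\<close> is not in \<open>T\<close>, the theory generated by \<open>T\<close> and
  \<open>a\<close> refutes it.\<close>

lemma forces_cut_theories:
  assumes "imp_fm \<phi>" "\<phi> \<in> subfms \<chi>" "ded_closed T"
  shows "forces (cut_theories \<chi>) (\<subseteq>) col (T \<inter> subfms \<chi>) \<phi> \<longleftrightarrow> \<phi> \<in> T"
  using assms
proof (induction \<phi> arbitrary: T)
  case (Var i)
  then show ?case by (simp add: col_def)
next
  case (Conj a b)
  then have "a \<in> subfms \<chi>" "b \<in> subfms \<chi>"
    using subfms_trans[OF Conj.prems(2)] subfms_self by auto
  then show ?case using Conj ded_closed_Conj by simp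
next
  case (Imp a b)
  then have sub: "a \<in> subfms \<chi>" "b \<in> subfms \<chi>"
    using subfms_trans[OF Imp.prems(2)] subfms_self by auto
  have IH: "forces (cut_theories \<chi>) (\<subseteq>) col (U \<inter> subfms \<chi>) a \<longleftrightarrow> a \<in> U"
    "forces (cut_theories \<chi>) (\<subseteq>) col (U \<inter> subfms \<chi>) b \<longleftrightarrow> b \<in> U" if "ded_closed U" for U
    using Imp sub that by auto
  have "forces (cut_theories \<chi>) (\<subseteq>) col (T \<inter> subfms \<chi>) (Imp a b) \<longleftrightarrow>
    (\<forall>U. ded_closed U \<longrightarrow> T \<inter> subfms \<chi> \<subseteq> U \<longrightarrow> a \<in> U \<longrightarrow> b \<in> U)" (is "_ \<longleftrightarrow> ?R")
    using IH by (auto simp: cut_theories_def)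
  also have "\<dots> \<longleftrightarrow> Imp a b \<in> T"
  proof
    assume ?R
    then show "Imp a b \<in> T" using ded_closed_extend[OF Imp.prems(3), of a] by blast
  next
    \<comment> \<open>The order compares only subformulas of \<open>\<chi>\<close>, so
      \<open>T\<close> need not be contained in \<open>U\<close>; but \<open>Imp a b\<close> is such
      a subformula and does pass to \<open>U\<close>.\<close>
    assume "Imp a b \<in> T"
    then show ?R using Imp.prems(2) unfolding ded_closed_def by blast
  qed
  finally show ?case .
qed auto

lemma finite_countermodel:
  assumes "imp_fm \<phi>" "imp_fm \<psi>" "\<not> ipc (Imp \<phi> \<psi>)"
  shows "\<exists>W :: fm set set. finite W \<and>
    (\<exists>w\<in>W. forces W (\<subseteq>) col w \<phi> \<and> \<not> forces W (\<subseteq>) col w \<psi>)"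
proof -
  \<comment> \<open>This choice makes both \<open>\<phi>\<close> and \<open>\<psi>\<close>
    subformulas; the refuting point is the theory of all consequences of
    \<open>\<phi>\<close>.\<close>
  let ?\<chi> = "Imp \<phi> \<psi>"
  let ?T = "{a. ipc (Imp \<phi> a)}"
  have "ded_closed {a. ipc a}"
    by (auto simp: ded_closed_def intro: ipc.mp)
  from ded_closed_extend(1)[OF this] have T: "ded_closed ?T"
    by simp
  then have "?T \<inter> subfms ?\<chi> \<in> cut_theories ?\<chi>" by (auto simp: cut_theories_def)
  moreover have "forces (cut_theories ?\<chi>) (\<subseteq>) col (?T \<inter> subfms ?\<chi>) \<phi>"
    using forces_cut_theories[OF assms(1) _ T, of ?\<chi>] subfms_self ipc_refl by auto
  moreover have "\<not> forces (cut_theories ?\<chi>) (\<subseteq>) col (?T \<inter> subfms ?\<chi>) \<psi>"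
    using forces_cut_theories[OF assms(2) _ T, of ?\<chi>] subfms_self assms(3) by auto
  ultimately show ?thesis using finite_cut_theories by blast
qed

section \<open>The universal model\<close>

interpretation U: kripke "Univ n" "(\<subseteq>)" col for n
  by (rule kripke_sets)

interpretation Us: kripke "Univ_s n" "(\<subseteq>)" col for n
  by (rule kripke_sets)

lemma Univ_s_eq: "Univ_s n = U.separated_points n n"
  by (simp add: Univ_s_def U.separated_points_def)

lemma finite_upset_Univ: "x \<in> Univ n \<Longrightarrow> finite {y \<in> Univ n. x \<subseteq> y}"
  by (rule finite_subset[of _ "{y \<in> Can n. x \<subseteq> y}"]) (auto simp: Univ_def)

lemma finite_upset_Univ_s: "x \<in> Univ_s n \<Longrightarrow> finite {y \<in> Univ_s n. x \<subseteq> y}"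
  by (rule finite_subset[OF _ finite_upset_Univ[of x n]]) (auto simp: Univ_s_def)

text \<open>The finite countermodel is moved into \<open>Univ n\<close> by its theory map and from
  there to the separated points.\<close>

lemma Univ_s_countermodel:
  assumes \<phi>: "imp_fm \<phi>" "\<phi> \<in> lang n" and \<psi>: "imp_fm \<psi>" "\<psi> \<in> lang n"
    and "\<not> ipc (Imp \<phi> \<psi>)"
  shows "\<exists>x\<in>Univ_s n. forces (Univ_s n) (\<subseteq>) col x \<phi> \<and> \<not> forces (Univ_s n) (\<subseteq>) col x \<psi>"
proof -
  obtain W :: "fm set set" and w where W: "finite W" and w: "w \<in> W"
    "forces W (\<subseteq>) col w \<phi>" "\<not> forces W (\<subseteq>) col w \<psi>"
    using finite_countermodel[OF \<phi>(1) \<psi>(1) assms(5)] by blast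
  interpret W: kripke W "(\<subseteq>)" col by (rule kripke_sets)
  have fin: "finite {y \<in> W. x \<subseteq> y}" for x
    using W by simp
  have p: "pmorph n W (\<subseteq>) col (Univ n) (\<subseteq>) col (W.truths n)"
    by (rule W.pmorph_truths[OF fin])
  define u where "u = W.truths n w"
  have u: "u \<in> Univ n" unfolding u_def by (rule W.truths_in_Univ[OF w(1) fin])
  have "forces (Univ n) (\<subseteq>) col u \<phi>" "\<not> forces (Univ n) (\<subseteq>) col u \<psi>"
    unfolding u_def forces_pmorph[OF p w(1) \<phi>(2)] forces_pmorph[OF p w(1) \<psi>(2)] by (rule w)+
  \<comment> \<open>Truth of \<open>\<phi>\<close> at \<open>u\<close> passes to every separated
    point above \<open>u\<close>, while failure of \<open>\<psi>\<close> at \<open>u\<close> passes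
    to at least one of them.\<close>
  then have \<phi>_s: "\<And>y. y \<in> Univ_s n \<Longrightarrow> u \<subseteq> y \<Longrightarrow> forces (Univ_s n) (\<subseteq>) col y \<phi>"
    and "\<not> (\<forall>y\<in>Univ_s n. u \<subseteq> y \<longrightarrow> forces (Univ_s n) (\<subseteq>) col y \<psi>)"
    unfolding Univ_s_eq
    using U.forces_separated_points[OF finite_upset_Univ \<phi> u]
      U.forces_separated_points[OF finite_upset_Univ \<psi> u] by blast+
  then show ?thesis by blast
qed

text \<open>Order reflection, which yields injectivity when applied both ways.
  \<open>Univ_ai n\<close> is a union of p-morphism images, so it lies between the image of
  \<open>?f\<close> and \<open>Univ n\<close>; hence \<open>?f\<close> is a p-morphism into it and
  carries the separated countermodel along.\<close>

lemma hmap_subset_imp_ipc: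
  assumes "imp_fm \<phi>" "\<phi> \<in> lang n" "imp_fm \<psi>" "\<psi> \<in> lang n" and sub: "hmap n \<phi> \<subseteq> hmap n \<psi>"
  shows "ipc (Imp \<phi> \<psi>)"
proof (rule ccontr)
  assume "\<not> ipc (Imp \<phi> \<psi>)"
  then obtain x where x: "x \<in> Univ_s n"
    "forces (Univ_s n) (\<subseteq>) col x \<phi>" "\<not> forces (Univ_s n) (\<subseteq>) col x \<psi>"
    using Univ_s_countermodel[OF assms(1-4)] by blast
  let ?f = "Us.truths n n"
  have p: "pmorph n (Univ_s n) (\<subseteq>) col (Univ n) (\<subseteq>) col ?f"
    by (rule Us.pmorph_truths[OF finite_upset_Univ_s])
  then have image: "?f ` Univ_s n \<subseteq> Univ_ai n"
    unfolding Univ_ai_def by (intro Union_upper) blast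
  have "g ` Univ_s n \<subseteq> Univ n" if "pmorph n (Univ_s n) (\<subseteq>) col (Univ n) (\<subseteq>) col g" for g
    using that by (simp add: pmorph_def image_subset_iff)
  then have "Univ_ai n \<subseteq> Univ n"
    unfolding Univ_ai_def by (intro Union_least) blast
  from pmorph_restrict_codomain[OF p image this]
  have q: "pmorph n (Univ_s n) (\<subseteq>) col (Univ_ai n) (\<subseteq>) col ?f" .
  have "?f x \<in> Univ_ai n" using image x(1) by blast
  then have "?f x \<in> hmap n \<phi>" "?f x \<notin> hmap n \<psi>"
    using forces_pmorph[OF q x(1)] x(2,3) assms(2,4) by (simp_all add: hmap_def)
  with sub show False by blast
qed

section \<open>Finiteness of the free implicative meet-semilattice\<close>

definition Fimp_class :: "nat \<Rightarrow> fm \<Rightarrow> fm set" where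
  "Fimp_class n \<phi> = {\<psi>. imp_fm \<psi> \<and> \<psi> \<in> lang n \<and> ipc_equiv \<phi> \<psi>}"

lemma Fimp_eq: "Fimp n = Fimp_class n ` {\<phi>. imp_fm \<phi> \<and> \<phi> \<in> lang n}"
  by (auto simp: Fimp_def Fimp_class_def)

lemma Fimp_class_cong:
  assumes "ipc_equiv \<phi> \<psi>" shows "Fimp_class n \<phi> = Fimp_class n \<psi>"
  using assms unfolding Fimp_class_def ipc_equiv_def by (blast intro: ipc_trans)

text \<open>Up to equivalence a formula is determined by which of the finitely many theories of
  points of \<open>Univ_s n\<close> contain it: two formulas with the same \<open>key\<close> have
  no separated countermodel in either direction.\<close>

lemma finite_Fimp: "finite (Fimp n)"
proof -
  let ?L = "{\<phi>. imp_fm \<phi> \<and> \<phi> \<in> lang n}"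
  let ?T = "Us.truths n n ` Univ_s n"
  define key where "key \<phi> = {t \<in> ?T. \<phi> \<in> t}" for \<phi>
  have "finite ?T"
    unfolding Univ_s_eq by (rule U.finite_truths_separated_points)
  then have "finite (key ` ?L)"
    by (rule finite_subset[rotated, OF finite_Pow_iff[THEN iffD2]]) (auto simp: key_def)
  then show ?thesis
    unfolding Fimp_eq
  proof (rule finite_image_if_determined)
    have imp: "ipc (Imp \<phi> \<psi>)" if "\<phi> \<in> ?L" "\<psi> \<in> ?L" "key \<phi> = key \<psi>" for \<phi> \<psi>
    proof (rule ccontr)
      have \<phi>: "imp_fm \<phi>" "\<phi> \<in> lang n" and \<psi>: "imp_fm \<psi>" "\<psi> \<in> lang n"
        using that by simp_all
      assume "\<not> ipc (Imp \<phi> \<psi>)"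
      then obtain x where x: "x \<in> Univ_s n" "\<phi> \<in> Us.truths n n x" "\<psi> \<notin> Us.truths n n x"
        using Univ_s_countermodel[OF \<phi> \<psi>] \<phi> \<psi> unfolding Us.truths_def by blast
      then have "Us.truths n n x \<in> key \<phi> - key \<psi>" by (simp add: key_def)
      with that show False by simp
    qed
    show "Fimp_class n \<phi> = Fimp_class n \<psi>" if "\<phi> \<in> ?L" "\<psi> \<in> ?L" "key \<phi> = key \<psi>" for \<phi> \<psi>
      using imp[of \<phi> \<psi>] imp[of \<psi> \<phi>] that by (intro Fimp_class_cong) (simp add: ipc_equiv_def)
  qed
qed

section \<open>Local finiteness\<close>

text \<open>The value \<open>undefined\<close> for \<open>Bot\<close> and \<open>Disj\<close> is a
  dummy; evaluation is meant for formulas satisfying \<open>imp_fm\<close>.\<close>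

fun eval_fm :: "('a \<Rightarrow> 'a \<Rightarrow> 'a) \<Rightarrow> ('a \<Rightarrow> 'a \<Rightarrow> 'a) \<Rightarrow> (nat \<Rightarrow> 'a) \<Rightarrow> fm \<Rightarrow> 'a" where
  "eval_fm m i s (Var j) = s j"
| "eval_fm m i s (Conj a b) = m (eval_fm m i s a) (eval_fm m i s b)"
| "eval_fm m i s (Imp a b) = i (eval_fm m i s a) (eval_fm m i s b)"
| "eval_fm m i s _ = undefined"

context
  fixes A :: "'a set" and m i :: "'a \<Rightarrow> 'a \<Rightarrow> 'a" and s :: "nat \<Rightarrow> 'a" and n :: nat
  assumes ims: "ims A m i" and s: "\<And>j. j < n \<Longrightarrow> s j \<in> A"
begin

private abbreviation le (infix "\<preceq>" 50) where "a \<preceq> b \<equiv> m a b = a"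
text \<open>The conjunct \<open>s j \<in> A\<close> makes the colouring monotone for every
  \<open>j\<close>, although membership of \<open>s j\<close> in \<open>A\<close> is given only for
  \<open>j < n\<close>.\<close>

private abbreviation "val x j \<equiv> s j \<in> A \<and> x \<preceq> s j"
private abbreviation "ev \<equiv> eval_fm m i s"

private lemma closed: "a \<in> A \<Longrightarrow> b \<in> A \<Longrightarrow> m a b \<in> A" "a \<in> A \<Longrightarrow> b \<in> A \<Longrightarrow> i a b \<in> A"
  and assoc: "a \<in> A \<Longrightarrow> b \<in> A \<Longrightarrow> c \<in> A \<Longrightarrow> m (m a b) c = m a (m b c)"
  and comm: "a \<in> A \<Longrightarrow> b \<in> A \<Longrightarrow> m a b = m b a"
  and idem: "a \<in> A \<Longrightarrow> m a a = a"
  and residuation: "a \<in> A \<Longrightarrow> b \<in> A \<Longrightarrow> c \<in> A \<Longrightarrow> m a b \<preceq> c \<longleftrightarrow> a \<preceq> i b c"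
  using ims unfolding ims_def by blast+

private lemma le_trans: "a \<in> A \<Longrightarrow> b \<in> A \<Longrightarrow> c \<in> A \<Longrightarrow> a \<preceq> b \<Longrightarrow> b \<preceq> c \<Longrightarrow> a \<preceq> c"
  by (metis assoc)

private lemma le_meet: "a \<in> A \<Longrightarrow> b \<in> A \<Longrightarrow> c \<in> A \<Longrightarrow> a \<preceq> m b c \<longleftrightarrow> a \<preceq> b \<and> a \<preceq> c"
  by (metis assoc comm idem closed(1))

private lemma eval_fm_closed: "imp_fm \<phi> \<Longrightarrow> \<phi> \<in> lang n \<Longrightarrow> ev \<phi> \<in> A"
  by (induction \<phi>) (auto intro: closed s)

private lemma kripke_ims: "kripke A (\<lambda>x y. y \<preceq> x) val"
  by unfold_locales (auto intro: idem le_trans, metis comm)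

private lemma forces_ims:
  "imp_fm \<phi> \<Longrightarrow> \<phi> \<in> lang n \<Longrightarrow> x \<in> A \<Longrightarrow>
    forces A (\<lambda>x y. y \<preceq> x) val x \<phi> \<longleftrightarrow> x \<preceq> ev \<phi>"
proof (induction \<phi> arbitrary: x)
  case (Var j)
  then show ?case using s by simp
next
  case (Conj a b)
  then show ?case using le_meet eval_fm_closed by simp
next
  case (Imp a b)
  then have A: "ev a \<in> A" "ev b \<in> A" using eval_fm_closed by auto
  \<comment> \<open>The elements below both \<open>x\<close> and \<open>ev a\<close> are those below
    their meet, so forcing an implication becomes the left side of residuation.\<close>
  have "(\<forall>y\<in>A. y \<preceq> x \<longrightarrow> y \<preceq> ev a \<longrightarrow> y \<preceq> ev b) \<longleftrightarrow> m x (ev a) \<preceq> ev b"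
  proof
    assume *: "\<forall>y\<in>A. y \<preceq> x \<longrightarrow> y \<preceq> ev a \<longrightarrow> y \<preceq> ev b"
    have "m x (ev a) \<preceq> x" "m x (ev a) \<preceq> ev a"
      using le_meet[of "m x (ev a)" x "ev a"] A Imp.prems(3) closed idem by auto
    with * show "m x (ev a) \<preceq> ev b" using A Imp.prems(3) closed by blast
  next
    assume *: "m x (ev a) \<preceq> ev b"
    have "y \<preceq> ev b" if "y \<in> A" "y \<preceq> x" "y \<preceq> ev a" for y
      using le_trans[OF _ _ _ _ *] le_meet[of y x "ev a"] that A Imp.prems(3) closed by auto
    then show "\<forall>y\<in>A. y \<preceq> x \<longrightarrow> y \<preceq> ev a \<longrightarrow> y \<preceq> ev b" by blast
  qed
  then show ?case using Imp residuation A by simp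
qed auto

text \<open>Soundness of a provable \<open>Imp \<alpha> \<beta>\<close> is applied at the point
  \<open>ev \<alpha>\<close>, which forces \<open>\<alpha>\<close> and hence lies below
  \<open>ev \<beta>\<close>.\<close>

lemma eval_fm_cong:
  assumes "imp_fm \<phi>" "\<phi> \<in> lang n" "imp_fm \<psi>" "\<psi> \<in> lang n" "ipc_equiv \<phi> \<psi>"
  shows "eval_fm m i s \<phi> = eval_fm m i s \<psi>"
proof -
  interpret kripke A "\<lambda>x y. y \<preceq> x" val by (rule kripke_ims)
  have "ev \<alpha> \<preceq> ev \<beta>" if "imp_fm \<alpha>" "\<alpha> \<in> lang n" "imp_fm \<beta>" "\<beta> \<in> lang n" "ipc (Imp \<alpha> \<beta>)" for \<alpha> \<beta>
    using soundness[OF that(5), of "ev \<alpha>"] forces_ims[of \<alpha>] forces_ims[of \<beta>]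
      eval_fm_closed[of \<alpha>] that idem by auto
  then have "ev \<phi> \<preceq> ev \<psi>" "ev \<psi> \<preceq> ev \<phi>" using assms by (auto simp: ipc_equiv_def)
  then show ?thesis using comm eval_fm_closed assms by metis
qed

lemma gen_subset_eval_fm:
  "gen m i (s ` {..<n}) \<subseteq> eval_fm m i s ` {\<phi>. imp_fm \<phi> \<and> \<phi> \<in> lang n}"
proof
  fix a assume "a \<in> gen m i (s ` {..<n})"
  then show "a \<in> ev ` {\<phi>. imp_fm \<phi> \<and> \<phi> \<in> lang n}"
  proof (induction rule: gen.induct)
    case (base a)
    then obtain j where "j < n" "a = s j" by auto
    then show ?case by (intro image_eqI[of _ _ "Var j"]) auto
  next
    case (meet a b)
    then obtain \<phi> \<psi> where "a = ev \<phi>" "b = ev \<psi>" "imp_fm \<phi>" "imp_fm \<psi>" "\<phi> \<in> lang n" "\<psi> \<in> lang n"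
      by auto
    then show ?case by (intro image_eqI[of _ _ "Conj \<phi> \<psi>"]) auto
  next
    case (imp a b)
    then obtain \<phi> \<psi> where "a = ev \<phi>" "b = ev \<psi>" "imp_fm \<phi>" "imp_fm \<psi>" "\<phi> \<in> lang n" "\<psi> \<in> lang n"
      by auto
    then show ?case by (intro image_eqI[of _ _ "Imp \<phi> \<psi>"]) auto
  qed
qed

text \<open>Generated elements are values of formulas, and such a value depends only on the class of
  the formula in the finite \<open>Fimp n\<close>.\<close>

lemma finite_gen_image: "finite (gen m i (s ` {..<n}))"
proof (rule finite_subset[OF gen_subset_eval_fm])
  let ?L = "{\<phi>. imp_fm \<phi> \<and> \<phi> \<in> lang n}"
  have "ipc_equiv \<phi> \<psi>" if "\<psi> \<in> ?L" "Fimp_class n \<phi> = Fimp_class n \<psi>" for \<phi> \<psi>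
    using that ipc_equiv_refl[of \<psi>] unfolding Fimp_class_def by blast
  then show "finite (eval_fm m i s ` ?L)"
    using finite_Fimp[of n] unfolding Fimp_eq
    by (elim finite_image_if_determined) (auto intro: eval_fm_cong)
qed

end

lemma finite_gen:
  assumes "ims A m i" "finite S" "S \<subseteq> A"
  shows "finite (gen m i S)"
proof -
  \<comment> \<open>An enumeration of the generators interprets \<open>card S\<close>
    variables.\<close>
  obtain s where "bij_betw s {0..<card S} S"
    using ex_bij_betw_nat_finite[OF assms(2)] by blast
  then have S: "S = s ` {..<card S}"
    by (simp add: bij_betw_def atLeast0LessThan)
  then have "s j \<in> A" if "j < card S" for j
    using assms(3) that by blast
  with finite_gen_image[OF assms(1)] have "finite (gen m i (s ` {..<card S}))"
    by blast
  with S show ?thesis by simp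
qed

theorem theorem3p13:
  shows "(\<forall>n \<phi> \<psi>. imp_fm \<phi> \<and> \<phi> \<in> lang n \<and> imp_fm \<psi> \<and> \<psi> \<in> lang n
            \<and> hmap n \<phi> = hmap n \<psi> \<longrightarrow> ipc_equiv \<phi> \<psi>)
       \<and> (\<forall>n. finite (Fimp n))
       \<and> (\<forall>(A :: 'a set) m i S. ims A m i \<and> finite S \<and> S \<subseteq> A \<longrightarrow> finite (gen m i S))"
proof (intro conjI allI impI)
  fix n \<phi> \<psi>
  assume "imp_fm \<phi> \<and> \<phi> \<in> lang n \<and> imp_fm \<psi> \<and> \<psi> \<in> lang n \<and> hmap n \<phi> = hmap n \<psi>"
  then show "ipc_equiv \<phi> \<psi>"
    using hmap_subset_imp_ipc[of \<phi> n \<psi>] hmap_subset_imp_ipc[of \<psi> n \<phi>] by (simp add: ipc_equiv_def)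
next
  show "finite (Fimp n)" for n
    by (rule finite_Fimp)
next
  fix A :: "'a set" and m i S
  assume "ims A m i \<and> finite S \<and> S \<subseteq> A"
  then show "finite (gen m i S)"
    using finite_gen by blast
qed

end
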